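(* Let $\alpha\in(0,1]$, $n\in\mathbb{N}$, $p,q>0$ and $\gamma,\beta,\delta,\rho\in\mathbb{C}$ with $\mathrm{Re}(\gamma)>0$, $\mathrm{Re}(\beta)>0$, $\mathrm{Re}(\delta)>0$, $\mathrm{Re}(\rho)>0$ and $\mathrm{Re}(\gamma+p)>q$. Let $\mathcal{V}$ denote the truncated $\mathcal{V}$-fractional derivative of order $\alpha$ with these parameters, and $K=\dfrac{\Gamma(\gamma+\beta)(\delta)_p}{\Gamma(\beta)(\rho)_q}$. Suppose $f:[0,\infty)\to\mathbb{R}$ is $(n+1)$ times $\alpha$-differentiable on $[0,\infty)$, and let $s,t\in[0,\infty)$. Then $$f(t)=\sum_{k=0}^{n}\frac{1}{k!}\left(K\,\frac{t^\alpha-s^\alpha}{\alpha}\right)^{k}\mathcal{V}^{k}f(s)+\frac{1}{n!}\int_{s}^{t}\left(K\,\frac{t^\alpha-\tau^\alpha}{\alpha}\right)^{n}\mathcal{V}^{n+1}f(\tau)\,d_\omega\tau .$$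
   Context: Parameters as in the claim, with a truncation index $i$ (a positive integer). Put $(\rho)_{qk}=\Gamma(\rho+qk)/\Gamma(\rho)$, $(\delta)_{pk}=\Gamma(\delta+pk)/\Gamma(\delta)$, and $$H(z)=\Gamma(\beta)\sum_{k=0}^{i}\frac{(\rho)_{qk}}{(\delta)_{pk}}\frac{z^k}{\Gamma(\gamma k+\beta)}.$$ Truncated $\mathcal{V}$-fractional derivative of order $\alpha\in(0,1]$: for $f:[0,\infty)\to\mathbb{R}$ and $t>0$, $$\mathcal{V}f(t)=\lim_{\epsilon\to0}\frac{f\big(t\,H(\epsilon t^{-\alpha})\big)-f(t)}{\epsilon},$$ and $\mathcal{V}f(0)=\lim_{t\to0^+}\mathcal{V}f(t)$ when this limit exists. (Since $f$ is real-valued on $[0,\infty)$, the definition presupposes that $t\,H(\epsilon t^{-\alpha})\in[0,\infty)$ for all sufficiently small real $\epsilon$.) $f$ is called $\alpha$-differentiable where this exists. Iterates: $\mathcal{V}^0f=f$, $\mathcal{V}^{n}f=\mathcal{V}^{n-1}(\mathcal{V}f)$. $\mathcal{V}$-fractional integral: $\displaystyle\int_a^b f(x)\,d_\omega x:=K\int_a^b f(x)\,x^{\alpha-1}\,dx$ with $K$ as in the claim.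
   Formalization: If s = 0 or t = 0, f is additionally assumed continuous at 0 from the right; without this the claim fails (f(0) = 1, f = 0 on (0,∞), n = 0, s = 0, t = 1), since α-differentiability at 0 does not involve f(0). *)

theory Defs
  imports "HOL-Analysis.Analysis"
begin

definition gen_poch :: "complex \<Rightarrow> real \<Rightarrow> complex" where
  "gen_poch r x = Gamma (r + of_real x) / Gamma r"

definition v_H :: "nat \<Rightarrow> real \<Rightarrow> real \<Rightarrow> complex \<Rightarrow> complex \<Rightarrow> complex \<Rightarrow> complex \<Rightarrow> complex \<Rightarrow> complex" where
  "v_H i p q \<gamma> \<beta> \<delta> \<rho> z =
     Gamma \<beta> * (\<Sum>k\<le>i. gen_poch \<rho> (q * real k) / gen_poch \<delta> (p * real k)
                      * (z ^ k / Gamma (\<gamma> * of_nat k + \<beta>)))"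

definition v_const :: "real \<Rightarrow> real \<Rightarrow> complex \<Rightarrow> complex \<Rightarrow> complex \<Rightarrow> complex \<Rightarrow> complex" where
  "v_const p q \<gamma> \<beta> \<delta> \<rho> =
     Gamma (\<gamma> + \<beta>) * gen_poch \<delta> p / (Gamma \<beta> * gen_poch \<rho> q)"

definition v_arg :: "real \<Rightarrow> nat \<Rightarrow> real \<Rightarrow> real \<Rightarrow> complex \<Rightarrow> complex \<Rightarrow> complex \<Rightarrow> complex \<Rightarrow> real \<Rightarrow> real \<Rightarrow> complex" where
  "v_arg \<alpha> i p q \<gamma> \<beta> \<delta> \<rho> t \<epsilon> =
     of_real t * v_H i p q \<gamma> \<beta> \<delta> \<rho> (of_real (\<epsilon> * t powr (- \<alpha>)))"

text \<open>
  The parameters are complex, so the argument at which \<open>f\<close> is evaluated is a priori complex.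
  The difference quotient reads it off through \<open>Re\<close>; the predicate \<open>v_differentiable\<close> below
  demands that it really is a nonnegative real for all small \<open>\<epsilon>\<close>.
\<close>

definition v_quot :: "real \<Rightarrow> nat \<Rightarrow> real \<Rightarrow> real \<Rightarrow> complex \<Rightarrow> complex \<Rightarrow> complex \<Rightarrow> complex \<Rightarrow> (real \<Rightarrow> real) \<Rightarrow> real \<Rightarrow> real \<Rightarrow> real" where
  "v_quot \<alpha> i p q \<gamma> \<beta> \<delta> \<rho> f t \<epsilon> = (f (Re (v_arg \<alpha> i p q \<gamma> \<beta> \<delta> \<rho> t \<epsilon>)) - f t) / \<epsilon>"

definition v_deriv_pos :: "real \<Rightarrow> nat \<Rightarrow> real \<Rightarrow> real \<Rightarrow> complex \<Rightarrow> complex \<Rightarrow> complex \<Rightarrow> complex \<Rightarrow> (real \<Rightarrow> real) \<Rightarrow> real \<Rightarrow> real" where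
  "v_deriv_pos \<alpha> i p q \<gamma> \<beta> \<delta> \<rho> f t = Lim (at 0) (v_quot \<alpha> i p q \<gamma> \<beta> \<delta> \<rho> f t)"

text \<open>
  Functions on \<open>[0, \<infinity>)\<close> are represented by total functions whose values at negative arguments
  are irrelevant.
\<close>

definition v_deriv :: "real \<Rightarrow> nat \<Rightarrow> real \<Rightarrow> real \<Rightarrow> complex \<Rightarrow> complex \<Rightarrow> complex \<Rightarrow> complex \<Rightarrow> (real \<Rightarrow> real) \<Rightarrow> real \<Rightarrow> real" where
  "v_deriv \<alpha> i p q \<gamma> \<beta> \<delta> \<rho> f t =
     (if t > 0 then v_deriv_pos \<alpha> i p q \<gamma> \<beta> \<delta> \<rho> f t
      else Lim (at_right 0) (v_deriv_pos \<alpha> i p q \<gamma> \<beta> \<delta> \<rho> f))"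

definition v_differentiable_pos :: "real \<Rightarrow> nat \<Rightarrow> real \<Rightarrow> real \<Rightarrow> complex \<Rightarrow> complex \<Rightarrow> complex \<Rightarrow> complex \<Rightarrow> (real \<Rightarrow> real) \<Rightarrow> real \<Rightarrow> bool" where
  "v_differentiable_pos \<alpha> i p q \<gamma> \<beta> \<delta> \<rho> f t \<longleftrightarrow>
     (\<forall>\<^sub>F \<epsilon> in at 0. v_arg \<alpha> i p q \<gamma> \<beta> \<delta> \<rho> t \<epsilon> \<in> \<real>\<^sub>\<ge>\<^sub>0) \<and>
     (\<exists>L. (v_quot \<alpha> i p q \<gamma> \<beta> \<delta> \<rho> f t \<longlongrightarrow> L) (at 0))"

definition v_differentiable :: "real \<Rightarrow> nat \<Rightarrow> real \<Rightarrow> real \<Rightarrow> complex \<Rightarrow> complex \<Rightarrow> complex \<Rightarrow> complex \<Rightarrow> (real \<Rightarrow> real) \<Rightarrow> real \<Rightarrow> bool" where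
  "v_differentiable \<alpha> i p q \<gamma> \<beta> \<delta> \<rho> f t \<longleftrightarrow>
     (if t > 0 then v_differentiable_pos \<alpha> i p q \<gamma> \<beta> \<delta> \<rho> f t
      else (\<forall>\<^sub>F u in at_right 0. v_differentiable_pos \<alpha> i p q \<gamma> \<beta> \<delta> \<rho> f u) \<and>
           (\<exists>L. (v_deriv_pos \<alpha> i p q \<gamma> \<beta> \<delta> \<rho> f \<longlongrightarrow> L) (at_right 0)))"

definition v_times_differentiable :: "nat \<Rightarrow> real \<Rightarrow> nat \<Rightarrow> real \<Rightarrow> real \<Rightarrow> complex \<Rightarrow> complex \<Rightarrow> complex \<Rightarrow> complex \<Rightarrow> (real \<Rightarrow> real) \<Rightarrow> bool" where
  "v_times_differentiable m \<alpha> i p q \<gamma> \<beta> \<delta> \<rho> f \<longleftrightarrow>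
     (\<forall>k<m. \<forall>t\<ge>0. v_differentiable \<alpha> i p q \<gamma> \<beta> \<delta> \<rho> ((v_deriv \<alpha> i p q \<gamma> \<beta> \<delta> \<rho> ^^ k) f) t)"

text \<open>
  The integral is the Henstock--Kurzweil one, oriented (the limits may come in either order).
  The highest derivative in a Taylor formula need not be Lebesgue integrable, since it is only
  assumed to exist. The value of the weight at \<open>x = 0\<close> does not matter.
\<close>

definition v_integrable :: "real \<Rightarrow> real \<Rightarrow> real \<Rightarrow> (real \<Rightarrow> complex) \<Rightarrow> bool" where
  "v_integrable \<alpha> a b g \<longleftrightarrow>
     (\<lambda>x. g x * of_real (x powr (\<alpha> - 1))) integrable_on closed_segment a b"

definition v_integral :: "complex \<Rightarrow> real \<Rightarrow> real \<Rightarrow> real \<Rightarrow> (real \<Rightarrow> complex) \<Rightarrow> complex" where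
  "v_integral K \<alpha> a b g =
     K * (if a \<le> b then integral {a..b} (\<lambda>x. g x * of_real (x powr (\<alpha> - 1)))
          else - integral {b..a} (\<lambda>x. g x * of_real (x powr (\<alpha> - 1))))"

end

theory Submission
  imports Defs
begin

text \<open>
  Write \<open>H(z) = 1 + c z + \<dots>\<close>, so that \<open>c K = 1\<close>. Since \<open>t H(\<epsilon> t powr -\<alpha>)\<close> is real for small real \<open>\<epsilon>\<close>,
  the number \<open>c\<close>, and hence \<open>K\<close>, is real. The map \<open>\<epsilon> \<mapsto> t H(\<epsilon> t powr -\<alpha>)\<close> has the nonzero derivative
  \<open>c t powr (1 - \<alpha>)\<close> at \<open>0\<close> and covers a neighbourhood of \<open>t\<close>, so \<open>f\<close> is differentiable at every
  \<open>t > 0\<close> and \<open>f'(t) = K t powr (\<alpha> - 1) V f(t)\<close>. The sum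
  \<open>\<Sum>k\<le>n. (K (t powr \<alpha> - x powr \<alpha>) / \<alpha>) ^ k / k! V\<^sup>k f(x)\<close> then has a telescoping derivative in \<open>x\<close>,
  namely \<open>K x powr (\<alpha> - 1)\<close> times the integrand of the remainder, and the fundamental theorem of
  calculus applies even though this derivative need not be continuous.
\<close>

section \<open>Differentiation through a change of variable\<close>

lemma DERIV_reparametrised:
  fixes f \<phi> :: "real \<Rightarrow> real"
  assumes \<phi>: "(\<phi> has_real_derivative D) (at 0)" and "D \<noteq> 0" and cont: "continuous_on UNIV \<phi>"
    and lim: "((\<lambda>e. (f (\<phi> e) - f (\<phi> 0)) / e) \<longlongrightarrow> L) (at 0)"
  shows "(f has_real_derivative L / D) (at (\<phi> 0))"
  unfolding has_field_derivative_iff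
proof (rule topological_tendstoI)
  fix S assume S: "open S" "L / D \<in> S"
  have "((\<lambda>e. (\<phi> e - \<phi> 0) / e) \<longlongrightarrow> D) (at 0)"
    using \<phi> by (simp add: has_field_derivative_iff)
  from tendsto_divide[OF lim this \<open>D \<noteq> 0\<close>]
  have "\<forall>\<^sub>F e in at 0. ((f (\<phi> e) - f (\<phi> 0)) / e) / ((\<phi> e - \<phi> 0) / e) \<in> S"
    using S topological_tendstoD by blast
  then obtain d where d: "d > 0"
    and dS: "\<And>e. e \<noteq> 0 \<Longrightarrow> \<bar>e\<bar> < d \<Longrightarrow> ((f (\<phi> e) - f (\<phi> 0)) / e) / ((\<phi> e - \<phi> 0) / e) \<in> S"
    by (auto simp: eventually_at dist_real_def)
  have "\<phi> 0 \<in> interior (\<phi> ` ball 0 d)"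
  proof (rule sussmann_open_mapping[where S = UNIV and f' = "(*) D" and g' = "(*) (1 / D)"])
    show "(\<phi> has_derivative (*) D) (at 0)"
      using \<phi> by (simp add: has_field_derivative_def)
    show "bounded_linear ((*) (1 / D))"
      by (rule bounded_linear_mult_right)
  qed (use d \<open>D \<noteq> 0\<close> cont in auto)
  then have "\<forall>\<^sub>F y in at (\<phi> 0). y \<in> \<phi> ` ball 0 d"
    by (metis eventually_at_topological interior_subset open_interior subsetD)
  moreover have "\<forall>\<^sub>F y in at (\<phi> 0). y \<noteq> \<phi> 0"
    by (simp add: eventually_at_filter)
  ultimately show "\<forall>\<^sub>F y in at (\<phi> 0). (f y - f (\<phi> 0)) / (y - \<phi> 0) \<in> S"
  proof eventually_elim
    case (elim y)
    then obtain e where "y = \<phi> e" "\<bar>e\<bar> < d"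
      by (auto simp: dist_real_def)
    with elim dS[of e] show ?case by (cases "e = 0") auto
  qed
qed

section \<open>The coefficients of H and the reality of K\<close>

text \<open>The coefficient of \<open>z ^ k\<close> in \<open>v_H\<close>, with
  \<open>Gamma \<beta>\<close> absorbed so that the constant term is 1.\<close>

definition v_coeff :: "real \<Rightarrow> real \<Rightarrow> complex \<Rightarrow> complex \<Rightarrow> complex \<Rightarrow> complex \<Rightarrow> nat \<Rightarrow> complex" where
  "v_coeff p q \<gamma> \<beta> \<delta> \<rho> k =
     Gamma \<beta> * (gen_poch \<rho> (q * real k) / gen_poch \<delta> (p * real k) / Gamma (\<gamma> * of_nat k + \<beta>))"

lemma v_H_of_real:
  "v_H i p q \<gamma> \<beta> \<delta> \<rho> (of_real x) = (\<Sum>k\<le>i. of_real (x ^ k) * v_coeff p q \<gamma> \<beta> \<delta> \<rho> k)"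
  by (simp add: v_H_def v_coeff_def sum_distrib_left mult_ac)

lemma DERIV_power_sum_at_0:
  fixes a :: "nat \<Rightarrow> real"
  assumes "i \<ge> 1"
  shows "((\<lambda>x. \<Sum>k\<le>i. x ^ k * a k) has_real_derivative a 1) (at 0)"
proof -
  have "((\<lambda>x. \<Sum>k\<le>i. x ^ k * a k) has_real_derivative (\<Sum>k\<le>i. real k * 0 ^ (k - 1) * a k)) (at 0)"
    by (auto intro!: derivative_eq_intros)
  \<comment> \<open>The term \<open>k = 0\<close> vanishes through the factor \<open>real k\<close>,
    since \<open>0 ^ (0 - 1)\<close> is \<open>0 ^ 0 = 1\<close>; the terms with
    \<open>k \<ge> 2\<close> vanish through the power.\<close>
  also have "(\<Sum>k\<le>i. real k * 0 ^ (k - 1) * a k) = (\<Sum>k\<in>{1}. real k * 0 ^ (k - 1) * a k)"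
    using assms by (intro sum.mono_neutral_right) (auto simp: power_0_left)
  finally show ?thesis by simp
qed

text \<open>The total function \<open>Gamma\<close> takes the value 0 exactly at the poles, which
  are nonpositive integers.\<close>

lemma Gamma_nonzero_Re_pos:
  fixes z :: complex
  assumes "Re z > 0"
  shows "Gamma z \<noteq> 0"
  using assms by (auto simp: Gamma_eq_zero_iff elim!: nonpos_Ints_cases)

lemma gen_poch_0: "Re r > 0 \<Longrightarrow> gen_poch r 0 = 1"
  by (simp add: gen_poch_def Gamma_nonzero_Re_pos)

lemma gen_poch_nonzero: "Re r > 0 \<Longrightarrow> x \<ge> 0 \<Longrightarrow> gen_poch r x \<noteq> 0"
  by (simp add: gen_poch_def Gamma_nonzero_Re_pos)

lemma v_coeff_0:
  assumes "Re \<beta> > 0" "Re \<delta> > 0" "Re \<rho> > 0"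
  shows "v_coeff p q \<gamma> \<beta> \<delta> \<rho> 0 = 1"
  using assms by (simp add: v_coeff_def gen_poch_0 Gamma_nonzero_Re_pos)

lemma v_const_times_v_coeff_1:
  assumes "p > 0" "q > 0" "Re \<gamma> > 0" "Re \<beta> > 0" "Re \<delta> > 0" "Re \<rho> > 0"
  shows "v_const p q \<gamma> \<beta> \<delta> \<rho> * v_coeff p q \<gamma> \<beta> \<delta> \<rho> 1 = 1"
  using assms by (simp add: v_coeff_def v_const_def gen_poch_nonzero Gamma_nonzero_Re_pos)

text \<open>At \<open>t = 1\<close> the argument of \<open>f\<close> is \<open>H(\<epsilon>)\<close>
  itself. Its imaginary part is a real polynomial in \<open>\<epsilon>\<close> that vanishes near 0,
  so its derivative at 0 vanishes as well.\<close>

lemma Im_v_coeff_1: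
  assumes "i \<ge> 1" and "\<forall>\<^sub>F \<epsilon> in at 0. v_arg \<alpha> i p q \<gamma> \<beta> \<delta> \<rho> 1 \<epsilon> \<in> \<real>\<^sub>\<ge>\<^sub>0"
  shows "Im (v_coeff p q \<gamma> \<beta> \<delta> \<rho> 1) = 0"
proof -
  let ?P = "\<lambda>x. \<Sum>k\<le>i. x ^ k * Im (v_coeff p q \<gamma> \<beta> \<delta> \<rho> k)"
  have P: "(?P has_real_derivative Im (v_coeff p q \<gamma> \<beta> \<delta> \<rho> 1)) (at 0)"
    by (rule DERIV_power_sum_at_0) fact
  have "\<forall>\<^sub>F x in at 0. ?P x = 0"
    using assms(2)
  proof eventually_elim
    case (elim x)
    then show ?case
      by (auto simp: v_arg_def v_H_of_real complex_nonneg_Reals_iff simp del: of_real_power)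
  qed
  \<comment> \<open>The hypothesis covers only a punctured neighbourhood; continuity adds the point
    0, so that \<open>?P\<close> agrees with the zero function on a full neighbourhood.\<close>
  moreover from this have "?P 0 = 0"
  proof -
    have "(?P \<longlongrightarrow> ?P 0) (at 0)"
      using DERIV_isCont[OF P] by (simp only: isCont_def)
    moreover have "(?P \<longlongrightarrow> 0) (at 0)"
      using \<open>\<forall>\<^sub>F x in at 0. ?P x = 0\<close> by (rule tendsto_eventually)
    ultimately show ?thesis using tendsto_unique trivial_limit_at by blast
  qed
  ultimately have "\<forall>\<^sub>F x in nhds 0. ?P x = 0"
    by (simp only: eventually_nhds_conv_at simp_thms)
  then have "((\<lambda>x. 0) has_real_derivative Im (v_coeff p q \<gamma> \<beta> \<delta> \<rho> 1)) (at 0)"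
    using P DERIV_cong_ev[OF refl _ refl, of ?P "\<lambda>x. 0" 0] by blast
  then show ?thesis
    using DERIV_unique DERIV_const by blast
qed

section \<open>From the V-derivative to the ordinary derivative\<close>

text \<open>The change of variable \<open>?\<phi>\<close> has \<open>?\<phi> 0 = t\<close> and
  derivative \<open>c * t powr (1 - \<alpha>)\<close> at 0, so the ordinary derivative is the
  V-derivative divided by this number. The factor \<open>1 / c\<close> is the constant K.\<close>

lemma v_differentiable_imp_DERIV:
  assumes "i \<ge> 1" "t > 0" and \<beta>\<delta>\<rho>: "Re \<beta> > 0" "Re \<delta> > 0" "Re \<rho> > 0"
    and c: "v_coeff p q \<gamma> \<beta> \<delta> \<rho> 1 = of_real c" and "c \<noteq> 0"
    and f: "v_differentiable \<alpha> i p q \<gamma> \<beta> \<delta> \<rho> f t"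
  shows "(f has_real_derivative 1 / c * t powr (\<alpha> - 1) * v_deriv \<alpha> i p q \<gamma> \<beta> \<delta> \<rho> f t) (at t)"
proof -
  let ?\<phi> = "\<lambda>\<epsilon>. Re (v_arg \<alpha> i p q \<gamma> \<beta> \<delta> \<rho> t \<epsilon>)"
  let ?P = "\<lambda>x. \<Sum>k\<le>i. x ^ k * Re (v_coeff p q \<gamma> \<beta> \<delta> \<rho> k)"
  let ?D = "t * (c * t powr (- \<alpha>))"
  have \<phi>_eq: "?\<phi> = (\<lambda>\<epsilon>. t * ?P (\<epsilon> * t powr (- \<alpha>)))"
    by (auto simp: v_arg_def v_H_of_real fun_eq_iff simp del: of_real_power of_real_mult)
  have P: "(?P has_real_derivative c) (at 0)"
    using DERIV_power_sum_at_0[OF \<open>i \<ge> 1\<close>, of "\<lambda>k. Re (v_coeff p q \<gamma> \<beta> \<delta> \<rho> k)"] c by simp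
  have "((\<lambda>\<epsilon>. t * ?P (\<epsilon> * t powr (- \<alpha>))) has_real_derivative ?D) (at 0)"
    by (intro DERIV_cmult DERIV_chain2[of ?P]) (use P in \<open>auto intro!: derivative_eq_intros\<close>)
  then have D: "(?\<phi> has_real_derivative ?D) (at 0)"
    by (simp only: \<phi>_eq)
  have P0: "?P 0 = 1"
    using v_coeff_0[OF \<beta>\<delta>\<rho>, of p q \<gamma>] by (simp add: power_0_left if_distrib if_distribR cong: if_cong)
  have \<phi>0: "?\<phi> 0 = t"
    using P0 fun_cong[OF \<phi>_eq, of 0] by simp
  have cont: "continuous_on UNIV ?\<phi>"
    unfolding \<phi>_eq by (intro continuous_intros)
  obtain L where L: "(v_quot \<alpha> i p q \<gamma> \<beta> \<delta> \<rho> f t \<longlongrightarrow> L) (at 0)"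
    using f \<open>t > 0\<close> by (auto simp: v_differentiable_def v_differentiable_pos_def)
  then have V: "v_deriv \<alpha> i p q \<gamma> \<beta> \<delta> \<rho> f t = L"
    using \<open>t > 0\<close> by (simp add: v_deriv_def v_deriv_pos_def tendsto_Lim)
  have "((\<lambda>e. (f (?\<phi> e) - f (?\<phi> 0)) / e) \<longlongrightarrow> L) (at 0)"
    using L unfolding \<phi>0 v_quot_def .
  then have "(f has_real_derivative L / ?D) (at (?\<phi> 0))"
    by (intro DERIV_reparametrised D cont) (use \<open>t > 0\<close> \<open>c \<noteq> 0\<close> in auto)
  moreover have "L / ?D = 1 / c * t powr (\<alpha> - 1) * L"
    using \<open>t > 0\<close> by (simp add: powr_minus powr_diff field_simps)
  ultimately show ?thesis
    unfolding \<phi>0 V by simp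
qed

text \<open>The value at 0 is by definition the limit from the right. This makes every iterate after
  \<open>f\<close> itself continuous up to the endpoint 0.\<close>

lemma continuous_within_v_deriv_0:
  assumes "v_differentiable \<alpha> i p q \<gamma> \<beta> \<delta> \<rho> f 0"
  shows "continuous (at 0 within {0..}) (v_deriv \<alpha> i p q \<gamma> \<beta> \<delta> \<rho> f)"
proof -
  let ?V = "v_deriv \<alpha> i p q \<gamma> \<beta> \<delta> \<rho> f"
  obtain L where L: "(v_deriv_pos \<alpha> i p q \<gamma> \<beta> \<delta> \<rho> f \<longlongrightarrow> L) (at_right 0)"
    using assms by (auto simp: v_differentiable_def)
  then have "?V 0 = L"
    by (simp add: v_deriv_def tendsto_Lim)
  moreover have "(?V \<longlongrightarrow> L) (at_right 0)"
    using L by (rule Lim_transform_eventually) (auto simp: eventually_at_filter v_deriv_def)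
  ultimately show ?thesis
    by (simp add: continuous_within at_within_Ici_at_right)
qed

section \<open>The integral remainder for a chain of weighted derivatives\<close>

text \<open>Only the relation between consecutive \<open>g k\<close> matters here. The point
  \<open>t\<close> is not tied to \<open>a\<close> or \<open>b\<close>, so the lemma serves both
  orders of \<open>s\<close> and \<open>t\<close>.\<close>

lemma has_integral_taylor_powr:
  fixes g :: "nat \<Rightarrow> real \<Rightarrow> real"
  assumes "\<alpha> > 0" "0 \<le> a" "a \<le> b" "\<kappa> \<noteq> 0"
    and W: "\<And>x. W x = \<kappa> * ((t powr \<alpha> - x powr \<alpha>) / \<alpha>)"
    and deriv: "\<And>k x. k \<le> n \<Longrightarrow> x > 0 \<Longrightarrow>
      (g k has_real_derivative \<kappa> * x powr (\<alpha> - 1) * g (Suc k) x) (at x)"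
    and cont: "\<And>k. k \<le> n \<Longrightarrow> continuous_on {a..b} (g k)"
  defines "G \<equiv> \<lambda>x. \<Sum>k\<le>n. 1 / fact k * W x ^ k * g k x"
  shows "((\<lambda>x. W x ^ n * g (Suc n) x * x powr (\<alpha> - 1)) has_integral
    fact n / \<kappa> * (G b - G a)) {a..b}"
proof -
  have WD: "(W has_real_derivative - \<kappa> * x powr (\<alpha> - 1)) (at x)" if "x > 0" for x
    unfolding W[abs_def] using that \<open>\<alpha> > 0\<close>
    by (auto intro!: derivative_eq_intros simp: powr_diff field_simps)
  have GD: "((\<lambda>x. \<Sum>k\<le>m. 1 / fact k * W x ^ k * g k x) has_real_derivative
      1 / fact m * W x ^ m * (\<kappa> * x powr (\<alpha> - 1) * g (Suc m) x)) (at x)"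
    if "x > 0" "m \<le> n" for x m
    using \<open>m \<le> n\<close>
  proof (induction m)
    case 0
    then show ?case using deriv[of 0 x] \<open>x > 0\<close> by simp
  next
    case (Suc m)
    have "((\<lambda>x. 1 / fact (Suc m) * W x ^ Suc m * g (Suc m) x) has_real_derivative
        1 / fact (Suc m) * (of_nat (Suc m) * W x ^ m * (- \<kappa> * x powr (\<alpha> - 1))) * g (Suc m) x +
        1 / fact (Suc m) * W x ^ Suc m * (\<kappa> * x powr (\<alpha> - 1) * g (Suc (Suc m)) x)) (at x)"
      using DERIV_mult[OF DERIV_cmult[OF DERIV_power_Suc[OF WD[OF \<open>x > 0\<close>], of m], of "1 / fact (Suc m)"]
          deriv[OF Suc.prems \<open>x > 0\<close>]]
      by (simp add: algebra_simps)
    moreover have "1 / fact (Suc m) * (of_nat (Suc m) * y * z) = 1 / fact m * y * z" for y z :: real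
      by (simp add: field_simps del: of_nat_Suc)
    \<comment> \<open>The subtracted term is exactly the derivative of the sum up to
      \<open>m\<close>, so adding the next summand leaves only the term with
      \<open>g (Suc (Suc m))\<close>.\<close>
    ultimately have "((\<lambda>x. 1 / fact (Suc m) * W x ^ Suc m * g (Suc m) x) has_real_derivative
        1 / fact (Suc m) * W x ^ Suc m * (\<kappa> * x powr (\<alpha> - 1) * g (Suc (Suc m)) x) -
        1 / fact m * W x ^ m * (\<kappa> * x powr (\<alpha> - 1) * g (Suc m) x)) (at x)"
      by (simp only:) (simp add: algebra_simps)
    from DERIV_add[OF Suc.IH this] Suc.prems show ?case
      by (simp del: fact_Suc power_Suc)
  qed
  have "continuous_on {a..b} W"
    unfolding W[abs_def] using \<open>\<alpha> > 0\<close> \<open>0 \<le> a\<close>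
    by (intro continuous_intros continuous_on_powr') auto
  then have "continuous_on {a..b} G"
    unfolding G_def by (intro continuous_intros cont) auto
  \<comment> \<open>The derivative is required only inside the interval, where \<open>x > 0\<close>;
    at a possible endpoint 0 the continuity of \<open>G\<close> suffices.\<close>
  then have "((\<lambda>x. 1 / fact n * W x ^ n * (\<kappa> * x powr (\<alpha> - 1) * g (Suc n) x)) has_integral
      G b - G a) {a..b}"
    using GD[of _ n] \<open>0 \<le> a\<close> \<open>a \<le> b\<close>
    by (intro fundamental_theorem_of_calculus_interior)
       (auto simp: has_real_derivative_iff_has_vector_derivative[symmetric] G_def)
  from has_integral_mult_right[OF this, of "fact n / \<kappa>"] show ?thesis
    using \<open>\<kappa> \<noteq> 0\<close> by (simp add: mult_ac)
qed

theorem theorem8: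
  fixes \<alpha> p q s t :: real and \<gamma> \<beta> \<delta> \<rho> K :: complex and n i :: nat and f :: "real \<Rightarrow> real"
    and V :: "(real \<Rightarrow> real) \<Rightarrow> real \<Rightarrow> real"
  defines "V \<equiv> v_deriv \<alpha> i p q \<gamma> \<beta> \<delta> \<rho>"
    and "K \<equiv> v_const p q \<gamma> \<beta> \<delta> \<rho>"
  assumes "0 < \<alpha>" "\<alpha> \<le> 1" and "i \<ge> 1" and "p > 0" "q > 0"
    and "Re \<gamma> > 0" "Re \<beta> > 0" "Re \<delta> > 0" "Re \<rho> > 0" "Re (\<gamma> + of_real p) > q"
    and "v_times_differentiable (n + 1) \<alpha> i p q \<gamma> \<beta> \<delta> \<rho> f"
    and "s \<ge> 0" "t \<ge> 0"
    and "s = 0 \<or> t = 0 \<Longrightarrow> continuous (at 0 within {0..}) f"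
  shows "v_integrable \<alpha> s t
           (\<lambda>\<tau>. (K * of_real ((t powr \<alpha> - \<tau> powr \<alpha>) / \<alpha>)) ^ n * of_real ((V ^^ (n + 1)) f \<tau>)) \<and>
         of_real (f t) =
           (\<Sum>k\<le>n. 1 / fact k * (K * of_real ((t powr \<alpha> - s powr \<alpha>) / \<alpha>)) ^ k * of_real ((V ^^ k) f s)) +
           1 / fact n * v_integral K \<alpha> s t
             (\<lambda>\<tau>. (K * of_real ((t powr \<alpha> - \<tau> powr \<alpha>) / \<alpha>)) ^ n * of_real ((V ^^ (n + 1)) f \<tau>))"
proof -
  note pos = \<open>p > 0\<close> \<open>q > 0\<close> \<open>Re \<gamma> > 0\<close> \<open>Re \<beta> > 0\<close> \<open>Re \<delta> > 0\<close> \<open>Re \<rho> > 0\<close>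
  define g where "g k = (V ^^ k) f" for k
  have g0: "g 0 = f" and gSuc: "g (Suc k) = V (g k)" for k
    by (simp_all add: g_def)
  have diff: "v_differentiable \<alpha> i p q \<gamma> \<beta> \<delta> \<rho> (g k) x" if "k \<le> n" "x \<ge> 0" for k x
    using assms(13) that by (simp add: v_times_differentiable_def g_def V_def)
  define c where "c = Re (v_coeff p q \<gamma> \<beta> \<delta> \<rho> 1)"
  \<comment> \<open>Differentiability of \<open>f\<close> at the single point 1 already forces the
    linear coefficient, and with it K, to be real.\<close>
  have "Im (v_coeff p q \<gamma> \<beta> \<delta> \<rho> 1) = 0"
    using diff[of 0 1] \<open>i \<ge> 1\<close>
    by (intro Im_v_coeff_1) (auto simp: v_differentiable_def v_differentiable_pos_def)
  then have c: "v_coeff p q \<gamma> \<beta> \<delta> \<rho> 1 = of_real c"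
    by (simp add: c_def complex_eq_iff)
  have Kc: "K * of_real c = 1"
    using v_const_times_v_coeff_1[OF pos] by (simp only: K_def c)
  then have "c \<noteq> 0" by auto
  define \<kappa> where "\<kappa> = 1 / c"
  have "\<kappa> \<noteq> 0" using \<open>c \<noteq> 0\<close> by (simp add: \<kappa>_def)
  have K: "K = of_real \<kappa>"
    using Kc \<open>c \<noteq> 0\<close> by (simp add: \<kappa>_def field_simps)
  have deriv: "(g k has_real_derivative \<kappa> * x powr (\<alpha> - 1) * g (Suc k) x) (at x)"
    if "k \<le> n" "x > 0" for k x
    using v_differentiable_imp_DERIV[OF \<open>i \<ge> 1\<close> \<open>x > 0\<close> pos(4-6) c \<open>c \<noteq> 0\<close> diff] that
    by (simp add: \<kappa>_def gSuc V_def)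
  have cont: "continuous_on {min s t..max s t} (g k)" if "k \<le> n" for k
    unfolding continuous_on_eq_continuous_within
  proof
    fix x assume x: "x \<in> {min s t..max s t}"
    show "continuous (at x within {min s t..max s t}) (g k)"
    proof (cases "x > 0")
      case True
      then show ?thesis
        using deriv[OF \<open>k \<le> n\<close>] DERIV_continuous has_field_derivative_at_within by blast
    next
      case False
      with x \<open>s \<ge> 0\<close> \<open>t \<ge> 0\<close> have "x = 0" and st: "s = 0 \<or> t = 0" by auto
      \<comment> \<open>Differentiability at 0 does not constrain the value \<open>f 0\<close>, so
        for \<open>k = 0\<close> the continuity hypothesis on \<open>f\<close> enters; for
        \<open>k > 0\<close> the value at 0 is a limit.\<close>
      have "continuous (at 0 within {0..}) (g k)"
      proof (cases k)
        case 0
        then show ?thesis using assms(16) st by (simp add: g0)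
      next
        case (Suc j)
        then show ?thesis
          using continuous_within_v_deriv_0[OF diff[of j 0]] \<open>k \<le> n\<close> by (simp add: gSuc V_def)
      qed
      then show ?thesis
        unfolding \<open>x = 0\<close> by (rule continuous_within_subset) (use \<open>s \<ge> 0\<close> \<open>t \<ge> 0\<close> in auto)
    qed
  qed
  define W where "W x = \<kappa> * ((t powr \<alpha> - x powr \<alpha>) / \<alpha>)" for x
  define G where "G x = (\<Sum>k\<le>n. 1 / fact k * W x ^ k * g k x)" for x
  define h where "h x = W x ^ n * g (Suc n) x * x powr (\<alpha> - 1)" for x
  \<comment> \<open>At \<open>t\<close> only the summand \<open>k = 0\<close> of \<open>G\<close>
    survives, since \<open>0 ^ 0 = 1\<close>.\<close>
  have "W t = 0" by (simp add: W_def)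
  then have Gt: "G t = f t"
    by (simp add: G_def power_0_left g0 if_distrib if_distribR cong: if_cong)
  have "(h has_integral fact n / \<kappa> * (G (max s t) - G (min s t))) {min s t..max s t}"
    unfolding h_def G_def
    by (rule has_integral_taylor_powr[where \<kappa> = \<kappa> and t = t])
       (use \<open>0 < \<alpha>\<close> \<open>s \<ge> 0\<close> \<open>t \<ge> 0\<close> \<open>\<kappa> \<noteq> 0\<close> deriv cont in \<open>auto simp: W_def\<close>)
  then have I: "((\<lambda>x. complex_of_real (h x)) has_integral
      of_real (fact n / \<kappa> * (G (max s t) - G (min s t)))) {min s t..max s t}"
    by (rule has_integral_of_real)
  have integrand: "(K * of_real ((t powr \<alpha> - x powr \<alpha>) / \<alpha>)) ^ n * of_real ((V ^^ (n + 1)) f x) *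
      of_real (x powr (\<alpha> - 1)) = complex_of_real (h x)" for x
    by (simp add: h_def W_def K g_def)
  have "v_integral K \<alpha> s t
      (\<lambda>\<tau>. (K * of_real ((t powr \<alpha> - \<tau> powr \<alpha>) / \<alpha>)) ^ n * of_real ((V ^^ (n + 1)) f \<tau>)) =
      of_real (fact n * (G t - G s))"
    \<comment> \<open>The factor \<open>K = \<kappa>\<close> of the integral cancels the denominator
      \<open>\<kappa>\<close>; for \<open>s > t\<close> the minus sign of the oriented integral
      turns \<open>G s - G t\<close> into \<open>G t - G s\<close>.\<close>
    unfolding v_integral_def integrand
    using I \<open>\<kappa> \<noteq> 0\<close>
    by (auto simp: K min_def max_def field_simps dest!: integral_unique split: if_splits)
  moreover have "(\<Sum>k\<le>n. 1 / fact k * (K * of_real ((t powr \<alpha> - s powr \<alpha>) / \<alpha>)) ^ k *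
      of_real ((V ^^ k) f s)) = complex_of_real (G s)"
    by (simp add: G_def W_def K g_def)
  moreover have segment: "closed_segment s t = {min s t..max s t}"
    by (auto simp: closed_segment_eq_real_ivl)
  have "v_integrable \<alpha> s t
      (\<lambda>\<tau>. (K * of_real ((t powr \<alpha> - \<tau> powr \<alpha>) / \<alpha>)) ^ n * of_real ((V ^^ (n + 1)) f \<tau>))"
    unfolding v_integrable_def integrand segment using I by (rule has_integral_integrable)
  ultimately show ?thesis
    by (simp only: Gt) simp
qed

end
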